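(* For a positive integer $y$ let $G(y)$ be the number of distinct primes in the set $\{\lfloor y/n\rfloor : 1\le n\le y\}$. Let $x=pq$ where $p$ and $q$ are odd primes, not necessarily distinct. Then $G(x)=G(x-1)+1$.
   Context: For a positive integer $y$, $\mathcal{G}(y)=\{\lfloor y/n\rfloor : n\in\mathbb{Z},\ 1\le n\le y,\ \lfloor y/n\rfloor \text{ is prime}\}$, regarded as a set (repeated values counted once), and $G(y)=|\mathcal{G}(y)|$. Here $\lfloor\cdot\rfloor$ is the floor function. *)

theory Defs
  imports Complex_Main "HOL-Computational_Algebra.Primes"
begin

definition floor_primes :: "nat \<Rightarrow> int set" where
  "floor_primes y =
     {\<lfloor>real y / real n\<rfloor> | n :: nat. 1 \<le> n \<and> n \<le> y \<and> prime \<lfloor>real y / real n\<rfloor>}"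

definition G :: "nat \<Rightarrow> nat" where
  "G y = card (floor_primes y)"

end

(*
  Passing from x - 1 to x changes the quotient floor(x/n) only when n divides x. For x = pq
  with p \<le> q the prime quotients gained in this way are p and q, and the quotients lost are
  even, so that only the prime 2 could be lost; it would come from p = 3 or q = 3, and then 2
  is also attained at n = x/3 + 1. The smaller prime p, if p < q, was already attained by x - 1
  at n = q - 1, whereas q was not attained.
*)
theory Submission
  imports Defs
begin

text \<open>Natural division replaces the real floor so that \<open>div_Suc\<close> can compare the
  quotients of y and y + 1.\<close>

definition prime_quotients :: "nat \<Rightarrow> nat set" where
  "prime_quotients y = {r. prime r \<and> (\<exists>n. y div n = r)}"

text \<open>The range condition on n is dropped: outside it the quotient is 0, also at n = 0.\<close>
lemma floor_primes_eq: "floor_primes y = int ` prime_quotients y"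
proof -
  have fl: "\<lfloor>real y / real n\<rfloor> = int (y div n)" for n
    by (rule floor_divide_of_nat_eq)
  have range: "1 \<le> n \<and> n \<le> y" if "prime (y div n)" for n
  proof -
    have "y div n \<noteq> 0" using that by (metis not_prime_0)
    then show ?thesis by (simp add: div_eq_0_iff)
  qed
  show ?thesis
    unfolding floor_primes_def prime_quotients_def fl using range by auto
qed

lemma G_eq: "G y = card (prime_quotients y)"
  by (simp add: G_def floor_primes_eq card_image)

lemma finite_prime_quotients: "finite (prime_quotients y)"
  by (rule finite_subset[of _ "{..y}"]) (auto simp: prime_quotients_def)

text \<open>Together the two claims give the count: inserting an absent element adds exactly one.
  Assuming \<open>p \<le> q\<close> fixes which factor is new and, by symmetry of the product, loses
  no generality.\<close>

lemma prime_quotients_mult: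
  fixes p q :: nat
  assumes p: "prime p" "odd p" and q: "prime q" "odd q" and "p \<le> q"
  shows "prime_quotients (p * q) = insert q (prime_quotients (p * q - 1))"
    and "q \<notin> prime_quotients (p * q - 1)"
proof -
  define y where "y = p * q - 1"
  have pos: "p > 0" "q > 0" using p q by (auto intro: prime_gt_0_nat)
  have p3: "p \<ge> 3"
    using p prime_ge_2_nat[of p] by (cases "p = 2") auto
  have Suc_y: "p * q = Suc y" using pos by (simp add: y_def)
  have odd: "odd (p * q)" using p q by simp
  show "q \<notin> prime_quotients (p * q - 1)"
  proof
    assume "q \<in> prime_quotients (p * q - 1)"
    then obtain n where n: "y div n = q"
      by (auto simp: prime_quotients_def y_def)
    have n0: "n > 0" using n pos by (cases n) auto
    \<comment> \<open>The lower bound on y forces n < p, the upper one pq \<le> qn + n, hence q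
      \<le> q(p - n) \<le> n < p, against \<open>p \<le> q\<close>.\<close>
    have "q * n \<le> y" using n by (metis div_times_less_eq_dividend)
    then have "q * n < q * p" using Suc_y by (simp add: mult.commute)
    then obtain m where m: "p = Suc (n + m)" using pos by (auto dest: less_imp_Suc_add)
    have "y < Suc q * n" using n n0 dividend_less_div_times[of n y] by simp
    then have "p * q \<le> Suc q * n" using Suc_y by simp
    then show False using m \<open>p \<le> q\<close> by (simp add: algebra_simps)
  qed
  have q_attained: "q \<in> prime_quotients (p * q)"
    using q pos by (auto simp: prime_quotients_def intro: exI[of _ p])
  have p_attained: "p \<in> prime_quotients y" if less: "p < q"
  proof -
    obtain m where m: "q = Suc (p + m)" using less_imp_Suc_add[OF less] by blast
    \<comment> \<open>Here p + m = q - 1, and (p + 1)(q - 1) = y + (q - p) > y.\<close>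
    have "y div (p + m) = p"
      by (rule div_nat_eqI) (use m pos in \<open>auto simp: y_def algebra_simps\<close>)
    then show ?thesis using p by (auto simp: prime_quotients_def)
  qed
  have quotient_p_or_q: "r = p \<or> r = q" if "p * q = r * n" "prime r" for r n
  proof -
    have "r dvd p * q" using that by simp
    then have "r dvd p \<or> r dvd q" using \<open>prime r\<close> by (simp add: prime_dvd_mult_iff)
    then show ?thesis using \<open>prime r\<close> p q by (auto simp: primes_dvd_imp_eq)
  qed
  have two: "2 \<in> prime_quotients (p * q)" if "p * q = 3 * n" for n
  proof -
    \<comment> \<open>This gives n \<ge> 3, whence 2(n + 1) \<le> 3n < 3(n + 1).\<close>
    have "p * q \<ge> 3 * 3" using p3 \<open>p \<le> q\<close> by (intro mult_mono) auto
    then have "(p * q) div Suc n = 2"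
      using that by (intro div_nat_eqI) auto
    then show ?thesis by (auto simp: prime_quotients_def)
  qed
  have "r \<in> prime_quotients (p * q)" if r_in: "r \<in> prime_quotients y" for r
  proof -
    obtain n where r: "prime r" and n: "y div n = r"
      using r_in by (auto simp: prime_quotients_def)
    show ?thesis
    proof (cases "n dvd p * q")
      case False
      then have "p * q div n = r" using n Suc_y by (simp add: div_Suc mod_eq_0_iff_dvd)
      then show ?thesis using r by (auto simp: prime_quotients_def)
    next
      case True
      then have "p * q div n = Suc r" using n Suc_y by (simp add: div_Suc)
      then have eq: "p * q = Suc r * n" using True by (metis dvd_div_mult_self)
      \<comment> \<open>\<open>Suc r\<close> divides the odd number pq, so it is odd. With r = 2,
        \<open>eq\<close> becomes pq = 3n, the case covered by \<open>two\<close>.\<close>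
      then have "even r" using odd by (metis even_Suc even_mult_iff)
      then have "r = 2" using r primes_dvd_imp_eq two_is_prime_nat by blast
      then show ?thesis using two[of n] eq by simp
    qed
  qed
  moreover have "r = q \<or> r \<in> prime_quotients y" if r_in: "r \<in> prime_quotients (p * q)" for r
  proof -
    obtain n where r: "prime r" and n: "p * q div n = r"
      using r_in by (auto simp: prime_quotients_def)
    show ?thesis
    proof (cases "n dvd p * q")
      case False
      then have "y div n = r" using n Suc_y by (simp add: div_Suc mod_eq_0_iff_dvd)
      then show ?thesis using r by (auto simp: prime_quotients_def)
    next
      case True
      then have "p * q = r * n" using n by (metis dvd_div_mult_self)
      then have "r = p \<or> r = q" using r quotient_p_or_q by blast
      \<comment> \<open>If p = q, the value p is q itself; otherwise p < q and
        \<open>p_attained\<close> applies.\<close>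
      then show ?thesis using p_attained \<open>p \<le> q\<close> by (cases "p = q") auto
    qed
  qed
  ultimately show "prime_quotients (p * q) = insert q (prime_quotients (p * q - 1))"
    using q_attained unfolding y_def by blast
qed

lemma G_mult:
  fixes p q :: nat
  assumes "prime p" "odd p" "prime q" "odd q" "p \<le> q"
  shows "G (p * q) = G (p * q - 1) + 1"
  using prime_quotients_mult[OF assms] by (simp add: G_eq finite_prime_quotients)

theorem theorem3:
  fixes p q x :: nat
  assumes "prime p" and "odd p"
    and "prime q" and "odd q"
    and "x = p * q"
  shows "G x = G (x - 1) + 1"
  using G_mult[of p q] G_mult[of q p] assms by (cases "p \<le> q") (auto simp: mult.commute)

end
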